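(* Let $k$ and $n$ be integers with $0<k\leq n$. Then \[ I_n(1/k)=n\sum_{j=1}^{\lfloor n/k\rfloor}\frac{\varphi(j)}{j}-k\,\Phi(\lfloor n/k\rfloor)-\sum_{j=1}^{\lfloor n/k\rfloor}\sum_{d\mid j}\mu(d)\left\{\frac{n}{d}\right\}. \]
   Context: For a positive integer $n$, the Farey sequence $F_n$ is the set of irreducible fractions $a/b$ with $0<a/b\leq 1$ and $1\leq b\leq n$ (the fraction $0/1$ is excluded). For $k>0$, $I_n(1/k)$ denotes the number of fractions $\alpha\in F_n$ with $\alpha<1/k$ (the rank of $1/k$ in $F_n$). $\varphi$ is Euler's totient function, $\Phi(m)=\sum_{j=1}^m\varphi(j)$, $\mu$ the Möbius function, and $\{x\}=x-\lfloor x\rfloor$ the fractional part. *)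

theory Defs
  imports "HOL-Number_Theory.Number_Theory" "HOL-Computational_Algebra.Squarefree"
begin

text \<open>Fractions are represented by their real values; since they are in lowest terms, distinct
  fractions have distinct values, so counting values counts fractions.\<close>

definition farey :: "nat \<Rightarrow> real set" where
  "farey n = {real a / real b | a b :: nat.
     coprime a b \<and> 0 < real a / real b \<and> real a / real b \<le> 1 \<and> 1 \<le> b \<and> b \<le> n}"

definition farey_rank :: "nat \<Rightarrow> real \<Rightarrow> nat" where
  "farey_rank n x = card {\<alpha> \<in> farey n. \<alpha> < x}"

definition totient_sum :: "nat \<Rightarrow> nat" where
  "totient_sum m = (\<Sum>j = 1..m. totient j)"

definition moebius :: "nat \<Rightarrow> int" where
  "moebius d = (if squarefree d then (-1) ^ card (prime_factors d) else 0)"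

end

theory Submission
  imports Defs
begin

text \<open>A reduced fraction a/b lies below 1/k iff k a < b, so a runs up to n div k and, for each a,
  one counts the b in (k a, n] coprime to a. Moebius inversion over the divisors d of a gives the sum
  of mu(d) (floor(n/d) - k a/d); splitting floor(n/d) = n/d - frac(n/d) and using that mu(d)/d sums to
  phi(a)/a yields the three terms.\<close>

section \<open>Squarefree divisors and the divisor sum of \<open>moebius\<close>\<close>

lemma prime_factorization_prod_primes:
  fixes S :: "nat set"
  assumes "finite S" and "\<And>p. p \<in> S \<Longrightarrow> prime p"
  shows "prime_factorization (\<Prod>S) = mset_set S"
proof -
  have "prime_factorization (prod_mset (mset_set S)) = mset_set S"
    using assms by (intro prime_factorization_prod_mset_primes) auto
  then show ?thesis
    by (simp add: prod_unfold_prod_mset)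
qed

lemma squarefree_prod_primes:
  fixes S :: "nat set"
  assumes "finite S" and "\<And>p. p \<in> S \<Longrightarrow> prime p"
  shows "squarefree (\<Prod>S)"
proof -
  have nz: "\<Prod>S \<noteq> 0"
    using assms by (auto dest: prime_gt_0_nat)
  have "multiplicity p (\<Prod>S) = 1" if "p \<in> S" for p
    using count_prime_factorization_prime[of p "\<Prod>S"] that assms
    by (simp add: prime_factorization_prod_primes[OF assms])
  then show ?thesis
    using nz assms by (simp add: squarefree_factorial_semiring' prime_factorization_prod_primes)
qed

lemma prod_prime_factors_squarefree:
  fixes d :: nat
  assumes "squarefree d"
  shows "\<Prod>(prime_factors d) = d"
proof -
  have "d \<noteq> 0"
    using assms by (metis not_squarefree_0)
  then have "(\<Prod>p\<in>prime_factors d. p ^ multiplicity p d) = d"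
    using prime_factorization_nat by simp
  moreover have "(\<Prod>p\<in>prime_factors d. p ^ multiplicity p d) = \<Prod>(prime_factors d)"
    using assms \<open>d \<noteq> 0\<close> by (intro prod.cong) (auto simp: squarefree_factorial_semiring')
  ultimately show ?thesis
    by simp
qed

text \<open>A squarefree number is the product of its primes, so \<open>Prod\<close> inverts
  \<open>prime_factors\<close>. This turns sums over squarefree divisors into sums over
  subsets.\<close>

lemma bij_betw_prime_factors_squarefree_divisors:
  fixes n :: nat
  assumes "n > 0"
  shows "bij_betw prime_factors {d. d dvd n \<and> squarefree d} (Pow (prime_factors n))"
proof (rule bij_betwI[where g = Prod])
  show "prime_factors \<in> {d. d dvd n \<and> squarefree d} \<rightarrow> Pow (prime_factors n)"
    using assms by (auto simp: prime_factors_dvd)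
  have fin: "finite S" and prm: "\<And>p. p \<in> S \<Longrightarrow> prime p" if "S \<in> Pow (prime_factors n)" for S
    using that finite_subset[of S "prime_factors n"] by auto
  show "Prod \<in> Pow (prime_factors n) \<rightarrow> {d. d dvd n \<and> squarefree d}"
  proof
    fix S assume S: "S \<in> Pow (prime_factors n)"
    have "\<Prod>S \<noteq> 0"
      using fin[OF S] prm[OF S] by (auto dest: prime_gt_0_nat)
    \<comment> \<open>Divisibility becomes inclusion of multisets: a prime of \<open>S\<close>
      counts once on the left and at least once on the right.\<close>
    moreover have "mset_set S \<subseteq># prime_factorization n"
    proof (rule mset_subset_eqI)
      show "count (mset_set S) p \<le> count (prime_factorization n) p" for p
        using S fin[OF S] by (cases "p \<in> S") (auto simp: Suc_le_eq simp del: in_prime_factors_iff)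
    qed
    ultimately have "\<Prod>S dvd n"
      using assms by (simp add: prime_factorization_prod_primes[OF fin[OF S] prm[OF S]]
          flip: prime_factorization_subset_iff_dvd)
    then show "\<Prod>S \<in> {d. d dvd n \<and> squarefree d}"
      using squarefree_prod_primes[OF fin[OF S] prm[OF S]] by simp
  qed
  show "\<Prod>(prime_factors d) = d" if "d \<in> {d. d dvd n \<and> squarefree d}" for d
    using that by (simp add: prod_prime_factors_squarefree)
  show "prime_factors (\<Prod>S) = S" if "S \<in> Pow (prime_factors n)" for S
    using fin[OF that] by (simp add: prime_factorization_prod_primes[OF fin[OF that] prm[OF that]])
qed

text \<open>Only squarefree divisors contribute, and their signs form an alternating sum over the
  subsets of \<open>prime_factors n\<close>, which cancels unless there are no primes.\<close>

lemma sum_moebius_divisors: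
  fixes n :: nat
  assumes "n > 0"
  shows "(\<Sum>d | d dvd n. moebius d) = (if n = 1 then 1 else 0)"
proof -
  have "(\<Sum>d | d dvd n. moebius d) = (\<Sum>d | d dvd n \<and> squarefree d. (-1) ^ card (prime_factors d))"
    using assms by (intro sum.mono_neutral_cong_right) (auto simp: moebius_def)
  also have "\<dots> = (\<Sum>S\<in>Pow (prime_factors n). (-1) ^ card S)"
    by (rule sum.reindex_bij_betw[OF bij_betw_prime_factors_squarefree_divisors[OF assms]])
  \<comment> \<open>Expanding the product, choosing the second 1 exactly at the primes in
    \<open>S\<close> yields the sign \<open>(-1) ^ card S\<close>.\<close>
  also have "\<dots> = (\<Prod>p\<in>prime_factors n. 1 - 1)"
    by (subst prod_diff_conv_sum) simp_all
  also have "\<dots> = (if n = 1 then 1 else 0)"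
  proof (cases "n = 1")
    case False
    then have "prime_factors n \<noteq> {}"
      using assms by (simp add: prime_factorization_empty_iff)
    then show ?thesis
      using False by (simp add: card_gt_0_iff)
  qed simp
  finally show ?thesis .
qed

section \<open>Counting integers coprime to a given one\<close>

lemma card_multiples_le:
  fixes d n :: nat
  assumes "d > 0"
  shows "card {b \<in> {1..n}. d dvd b} = n div d"
proof -
  have "{b \<in> {1..n}. d dvd b} = (\<lambda>i. d * i) ` {1..n div d}"
  proof (intro equalityI subsetI)
    fix b assume "b \<in> {b \<in> {1..n}. d dvd b}"
    then obtain i where "b = d * i" "1 \<le> b" "b \<le> n"
      by auto
    then show "b \<in> (\<lambda>i. d * i) ` {1..n div d}"
      using assms by (auto simp: less_eq_div_iff_mult_less_eq mult.commute intro!: imageI Suc_leI)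
  qed (use assms in \<open>auto simp: less_eq_div_iff_mult_less_eq mult.commute\<close>)
  then show ?thesis
    using assms by (simp add: card_image inj_on_def)
qed

text \<open>Moebius inversion: \<open>sum_moebius_divisors\<close> at \<open>gcd a b\<close> is the
  indicator of coprimality, and exchanging the sums leaves a count of multiples for each
  \<open>d\<close>.\<close>

lemma card_coprime_le:
  fixes a n :: nat
  assumes "a > 0"
  shows "int (card {b \<in> {1..n}. coprime a b}) = (\<Sum>d | d dvd a. moebius d * int (n div d))"
proof -
  have "int (card {b \<in> {1..n}. coprime a b}) = (\<Sum>b = 1..n. if coprime a b then 1 else 0)"
    by (simp add: sum.If_cases Int_def)
  also have "\<dots> = (\<Sum>b = 1..n. \<Sum>d | d dvd gcd a b. moebius d)"
  proof (rule sum.cong[OF refl])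
    fix b
    have "gcd a b > 0"
      using assms by simp
    then show "(if coprime a b then 1 else 0) = (\<Sum>d | d dvd gcd a b. moebius d)"
      by (simp only: sum_moebius_divisors coprime_iff_gcd_eq_1)
  qed
  \<comment> \<open>Padding with zeros makes the inner range independent of \<open>b\<close>, so
    that the sums can be exchanged.\<close>
  also have "\<dots> = (\<Sum>b = 1..n. \<Sum>d | d dvd a. if d dvd b then moebius d else 0)"
    using assms by (intro sum.cong[OF refl] sum.mono_neutral_cong_left) auto
  also have "\<dots> = (\<Sum>d | d dvd a. \<Sum>b = 1..n. if d dvd b then moebius d else 0)"
    by (rule sum.swap)
  also have "\<dots> = (\<Sum>d | d dvd a. moebius d * int (n div d))"
  proof (rule sum.cong[OF refl])
    fix d assume "d \<in> {d. d dvd a}"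
    then have "d > 0"
      using assms by (auto intro: dvd_pos_nat)
    have "(\<Sum>b = 1..n. if d dvd b then moebius d else 0) =
        moebius d * int (card {b \<in> {1..n}. d dvd b})"
      by (simp add: sum.If_cases Int_def)
    then show "(\<Sum>b = 1..n. if d dvd b then moebius d else 0) = moebius d * int (n div d)"
      by (simp only: card_multiples_le[OF \<open>d > 0\<close>])
  qed
  finally show ?thesis .
qed

text \<open>Every \<open>d\<close> dividing \<open>a\<close> also divides \<open>k * a\<close>, so
  the quotients are exact and no fractional parts arise.\<close>

lemma card_coprime_le_mult:
  fixes a k :: nat
  assumes "a > 0"
  shows "real (card {b \<in> {1..k * a}. coprime a b}) =
    real k * real a * (\<Sum>d | d dvd a. real_of_int (moebius d) / real d)"
proof -
  have "real (card {b \<in> {1..k * a}. coprime a b}) =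
      real_of_int (\<Sum>d | d dvd a. moebius d * int (k * a div d))"
    by (simp only: card_coprime_le[OF assms, symmetric] of_int_of_nat_eq)
  also have "\<dots> = (\<Sum>d | d dvd a. real k * real a * (real_of_int (moebius d) / real d))"
    by (auto intro!: sum.cong simp: real_of_nat_div)
  finally show ?thesis
    by (simp add: sum_distrib_left)
qed

text \<open>This is the case \<open>k = 1\<close> of the preceding count, where the numbers counted
  are the totatives of \<open>a\<close>.\<close>

lemma totient_div_eq_sum_moebius:
  fixes a :: nat
  assumes "a > 0"
  shows "real (totient a) / real a = (\<Sum>d | d dvd a. real_of_int (moebius d) / real d)"
proof -
  have "totatives a = {b \<in> {1..1 * a}. coprime a b}"
    by (auto simp: totatives_def coprime_commute)
  then have "real (totient a) = real a * (\<Sum>d | d dvd a. real_of_int (moebius d) / real d)"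
    using card_coprime_le_mult[OF assms, of 1] by (simp add: totient_def)
  then show ?thesis
    using assms by simp
qed

text \<open>The count up to \<open>k * a\<close> is subtracted from the count up to
  \<open>n\<close>. The former equals \<open>k * totient a\<close> exactly, so all fractional parts
  come from the latter.\<close>

lemma card_coprime_between:
  fixes a k n :: nat
  assumes "a > 0" and "k * a \<le> n"
  shows "real (card {b \<in> {k * a<..n}. coprime a b}) =
    real n * (real (totient a) / real a) - real k * real (totient a)
    - (\<Sum>d | d dvd a. real_of_int (moebius d) * frac (real n / real d))"
proof -
  have "{b \<in> {k * a<..n}. coprime a b} =
      {b \<in> {1..n}. coprime a b} - {b \<in> {1..k * a}. coprime a b}"
    by auto
  \<comment> \<open>Here \<open>k * a \<le> n\<close> enters; the inclusion lets the cardinalities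
    be subtracted.\<close>
  moreover have "{b \<in> {1..k * a}. coprime a b} \<subseteq> {b \<in> {1..n}. coprime a b}"
    using assms by auto
  ultimately have diff: "real (card {b \<in> {k * a<..n}. coprime a b}) =
      real (card {b \<in> {1..n}. coprime a b}) - real (card {b \<in> {1..k * a}. coprime a b})"
    by (simp add: card_Diff_subset of_nat_diff card_mono)
  have "real (card {b \<in> {1..n}. coprime a b}) =
      real_of_int (\<Sum>d | d dvd a. moebius d * int (n div d))"
    by (simp only: card_coprime_le[OF assms(1), symmetric] of_int_of_nat_eq)
  also have "\<dots> = (\<Sum>d | d dvd a. real n * (real_of_int (moebius d) / real d)
      - real_of_int (moebius d) * frac (real n / real d))"
    by (auto intro!: sum.cong simp: frac_def floor_divide_of_nat_eq algebra_simps)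
  also have "\<dots> = real n * (real (totient a) / real a)
      - (\<Sum>d | d dvd a. real_of_int (moebius d) * frac (real n / real d))"
    by (simp only: sum_subtractf sum_distrib_left[symmetric] totient_div_eq_sum_moebius[OF assms(1)])
  finally show ?thesis
    using diff card_coprime_le_mult[OF assms(1), of k] totient_div_eq_sum_moebius[OF assms(1)] assms(1)
    by (simp add: field_simps)
qed

section \<open>Farey fractions as coprime pairs\<close>

lemma coprime_fraction_inj:
  fixes a b c d :: nat
  assumes "coprime a b" and "coprime c d" and "b > 0" and "d > 0"
    and "real a / real b = real c / real d"
  shows "a = c \<and> b = d"
proof -
  have "real (a * d) = real (c * b)"
    using assms by (simp add: field_simps)
  then have "a * d = c * b"
    by (simp only: of_nat_eq_iff)
  then show ?thesis
    using assms coprime_crossproduct_nat[where a = a and b = c and c = d and d = b] by (simp add: ac_simps)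
qed

text \<open>Reduced representations are unique, so counting values amounts to counting the pairs in
  \<open>P\<close>. If \<open>k * a = n\<close>, the last summand is 0, as its interval is
  empty.\<close>

lemma farey_rank_unit_fraction:
  fixes k n :: nat
  assumes "k > 0"
  shows "farey_rank n (1 / real k) = (\<Sum>a = 1..n div k. card {b \<in> {k * a<..n}. coprime a b})"
proof -
  define P where "P = (SIGMA a:{1..n div k}. {b \<in> {k * a<..n}. coprime a b})"
  have "{\<alpha> \<in> farey n. \<alpha> < 1 / real k} = (\<lambda>(a, b). real a / real b) ` P"
  proof (intro equalityI subsetI)
    fix \<alpha> assume "\<alpha> \<in> {\<alpha> \<in> farey n. \<alpha> < 1 / real k}"
    then obtain a b :: nat where ab: "\<alpha> = real a / real b" "coprime a b" "0 < real a / real b"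
      "1 \<le> b" "b \<le> n" "real a / real b < 1 / real k"
      unfolding farey_def by blast
    then have "real (k * a) < real b"
      using assms by (simp add: field_simps)
    then have "k * a < b"
      by (simp only: of_nat_less_iff)
    moreover have "a \<le> n div k"
      using \<open>k * a < b\<close> \<open>b \<le> n\<close> assms by (simp add: less_eq_div_iff_mult_less_eq mult.commute)
    moreover have "a \<ge> 1"
      using ab(3) by (cases a) auto
    ultimately have "(a, b) \<in> P"
      using ab by (simp add: P_def)
    then show "\<alpha> \<in> (\<lambda>(a, b). real a / real b) ` P"
      using ab(1) by force
  next
    fix \<alpha> assume "\<alpha> \<in> (\<lambda>(a, b). real a / real b) ` P"
    then obtain a b where ab: "\<alpha> = real a / real b" "a \<ge> 1" "k * a < b" "b \<le> n" "coprime a b"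
      by (auto simp: P_def)
    \<comment> \<open>This gives \<open>a < b\<close>, hence the bound by 1 that membership in
      \<open>farey n\<close> demands.\<close>
    have "a \<le> k * a"
      using assms by simp
    with ab(3) have "a < b"
      by linarith
    have "real (k * a) < real b"
      using ab(3) by (simp only: of_nat_less_iff)
    then have "\<alpha> < 1 / real k"
      unfolding ab(1) using assms \<open>a < b\<close> by (simp add: field_simps)
    moreover have "\<alpha> \<in> farey n"
      unfolding farey_def using ab \<open>a < b\<close> by (intro CollectI exI[of _ a] exI[of _ b]) auto
    ultimately show "\<alpha> \<in> {\<alpha> \<in> farey n. \<alpha> < 1 / real k}"
      by simp
  qed
  moreover have "inj_on (\<lambda>(a, b). real a / real b) P"
  proof (rule inj_onI, clarify)
    fix a b c d assume "(a, b) \<in> P" "(c, d) \<in> P" "real a / real b = real c / real d"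
    then show "a = c \<and> b = d"
      by (intro coprime_fraction_inj) (auto simp: P_def)
  qed
  ultimately have "farey_rank n (1 / real k) = card P"
    by (simp add: farey_rank_def card_image)
  then show ?thesis
    by (simp add: P_def)
qed

theorem theorem2:
  fixes k n :: nat
  assumes "0 < k" and "k \<le> n"
  shows "real (farey_rank n (1 / real k)) =
    real n * (\<Sum>j = 1..nat \<lfloor>real n / real k\<rfloor>. real (totient j) / real j)
    - real k * real (totient_sum (nat \<lfloor>real n / real k\<rfloor>))
    - (\<Sum>j = 1..nat \<lfloor>real n / real k\<rfloor>. \<Sum>d | d dvd j. real_of_int (moebius d) * frac (real n / real d))"
proof -
  have floor: "nat \<lfloor>real n / real k\<rfloor> = n div k"
    by (simp add: floor_divide_of_nat_eq)
  \<comment> \<open>This supplies the second hypothesis of \<open>card_coprime_between\<close> for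
    every summand.\<close>
  have "k * a \<le> n" if "a \<le> n div k" for a
    using that assms(1) by (simp add: less_eq_div_iff_mult_less_eq mult.commute)
  then have "real (farey_rank n (1 / real k)) =
      (\<Sum>a = 1..n div k. real n * (real (totient a) / real a) - real k * real (totient a)
        - (\<Sum>d | d dvd a. real_of_int (moebius d) * frac (real n / real d)))"
    unfolding farey_rank_unit_fraction[OF assms(1)] of_nat_sum
    by (intro sum.cong refl card_coprime_between) auto
  then show ?thesis
    unfolding floor by (simp only: sum_subtractf sum_distrib_left totient_sum_def of_nat_sum)
qed

end
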